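(* The spatial projection of a geodesic of $\mathbf{P_{mec}}$ corresponding to initial momenta $\underline\lambda^{(1)}(0),\underline\lambda^{(2)}(0)$ with $\|\underline\lambda^{(2)}(0)\|\le1$ presents a cusp for the first time $t^1_{cusp}=t(s_{max})$ when $s=s_{max}$, where $$s_{max}=\frac12\log\frac{1+\mathfrak c^2+2\sqrt{\mathfrak c^2-W^2}}{\|\underline\lambda^{(2)}(0)+\underline\lambda^{(1)}(0)\|^2}.$$ For given $\underline\lambda^{(1)}(0)$ and $\underline\lambda^{(2)}(0)$, the spatial projection of the corresponding geodesic does not have a cusp for all end times if and only if $\|\underline\lambda^{(2)}(0)+\underline\lambda^{(1)}(0)\|=0$.
   Context: Throughout $\xi=1$. $SE(3)=\mathbb R^3\rtimes SO(3)$, $e=(\mathbf 0,I)$. $\mathbf{P_{mec}}$ is the sub-Riemannian problem on $SE(3)/(\{\mathbf 0\}\times SO(2))$ induced by $\Delta=\mathrm{span}\{\mathcal A_3,\mathcal A_4,\mathcal A_5\}$ with $\mathcal A_3,\mathcal A_4,\mathcal A_5$ orthonormal, where $\mathcal A_3$ is the left-invariant field generating translation along $\mathbf e_z$ and $\mathcal A_4,\mathcal A_5$ those generating rotations about the $x$- and $y$-axis. Its geodesics are obtained from the Hamiltonian system of the Pontryagin Maximum Principle on $SE(3)$ with vanishing sixth momentum component: with momentum $(\lambda_1,\dots,\lambda_5)$, $\lambda_6=0$, normalized by $\lambda_3^2+\lambda_4^2+\lambda_5^2=1$, $\dot\gamma=\lambda_3\mathcal A_3+\lambda_4\mathcal A_4+\lambda_5\mathcal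 A_5$, $\gamma(0)=e$, $\frac{d}{dt}(\lambda_1,\lambda_2,\lambda_3,\lambda_4,\lambda_5)=(-\lambda_3\lambda_5,\lambda_3\lambda_4,\lambda_1\lambda_5-\lambda_2\lambda_4,\lambda_3\lambda_2,-\lambda_3\lambda_1)$, with $t$ sub-Riemannian arclength; initially $\lambda_3(0)=\sqrt{1-\lambda_4(0)^2-\lambda_5(0)^2}\ge0$. Spatial arclength $s$ satisfies $ds/dt=\lambda_3$ as long as $\lambda_3>0$, and in this parameter $\lambda_1(s)=\lambda_1(0)\cosh s-\lambda_5(0)\sinh s$, $\lambda_5(s)=\lambda_5(0)\cosh s-\lambda_1(0)\sinh s$, $\lambda_2(s)=\lambda_2(0)\cosh s+\lambda_4(0)\sinh s$, $\lambda_4(s)=\lambda_4(0)\cosh s+\lambda_2(0)\sinh s$, $\lambda_3(s)=\sqrt{1-\lambda_4(s)^2-\lambda_5(s)^2}$. Notation: $\underline\lambda^{(1)}=(-\lambda_1,-\lambda_2)$, $\underline\lambda^{(2)}=(\lambda_5,-\lambda_4)$; first integrals $W=-\lambda_1\lambda_4-\lambda_2\lambda_5$ and $\mathfrak c=\sqrt{\lambda_1^2+\lambda_2^2+\lambda_3^2}=\sqrt{\|\underline\lambda^{(1)}\|^2-\|\underline\lambda^{(2)}\|^2+1}$. A cusp time is a time $t_{cusp}>0$ (interior to the time interval) at which $u^3=\lambda_3$ vanishes with $\dot u^3\neq0$; the first cusp occurs at spatial arclength $s_{max}=\min\{s>0\mid\lambda_3(s)=0\}$.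
   Formalization: If ‖λ⁽²⁾(0)‖ = 1, it is additionally assumed that λ₃ > 0 just after t = 0 (the claim fails otherwise, e.g. for λ⁽¹⁾(0) = 0, where λ₃ ≡ 0); the formula for s_max is asserted when ‖λ⁽²⁾(0)+λ⁽¹⁾(0)‖ ≠ 0. *)

theory Defs
  imports "HOL-Analysis.Analysis"
begin

text \<open>Elements of \<open>SE(3)\<close> are pairs \<open>(x, R)\<close> with \<open>R \<in> SO(3)\<close>, multiplied by
  \<open>(x, R) \<cdot> (y, Q) = (x + R y, R Q)\<close>.\<close>

type_synonym se3 = "(real^3) \<times> (real^3^3)"

definition SE3 :: "se3 set" where
  "SE3 = {g. rotation_matrix (snd g)}"

definition SE3_unit :: se3 where
  "SE3_unit = (0, mat 1)"

text \<open>The left-invariant vector field with value \<open>X\<close> at the unit element: left multiplication by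
  \<open>g = (x, R)\<close> is affine in \<open>(y, Q)\<close>, and its differential sends \<open>(v, \<Omega>)\<close> to \<open>(R v, R \<Omega>)\<close>.\<close>

definition left_inv_field :: "se3 \<Rightarrow> se3 \<Rightarrow> se3" where
  "left_inv_field X g = (snd g *v fst X, snd g ** snd X)"

text \<open>Generator \<open>v \<mapsto> w \<times> v\<close> of the rotations about the axis \<open>w\<close>.\<close>

definition rot_gen :: "real^3 \<Rightarrow> real^3^3" where
  "rot_gen w = matrix (\<lambda>v. cross3 w v)"

definition A3 :: "se3 \<Rightarrow> se3" where
  "A3 = left_inv_field (axis 3 1, 0)"

definition A4 :: "se3 \<Rightarrow> se3" where
  "A4 = left_inv_field (0, rot_gen (axis 1 1))"

definition A5 :: "se3 \<Rightarrow> se3" where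
  "A5 = left_inv_field (0, rot_gen (axis 2 1))"

text \<open>A curve \<open>\<gamma>\<close> in \<open>SE(3)\<close> with momentum \<open>lam\<close>, parametrized by sub-Riemannian
  arclength \<open>t \<ge> 0\<close>. The restrictions to \<open>[0, T]\<close> are the geodesics with end time \<open>T\<close>; since
  the momentum stays bounded, every geodesic is such a restriction.\<close>

definition mec_geodesic :: "(real \<Rightarrow> se3) \<Rightarrow> (real \<Rightarrow> real^6) \<Rightarrow> bool" where
  "mec_geodesic \<gamma> lam \<longleftrightarrow>
     \<gamma> 0 = SE3_unit \<and>
     lam 0 $ 3 = sqrt (1 - (lam 0 $ 4)\<^sup>2 - (lam 0 $ 5)\<^sup>2) \<and>
     (\<forall>t\<ge>0.
        \<gamma> t \<in> SE3 \<and>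
        (\<gamma> has_vector_derivative
           (lam t $ 3 *\<^sub>R A3 (\<gamma> t) + lam t $ 4 *\<^sub>R A4 (\<gamma> t) + lam t $ 5 *\<^sub>R A5 (\<gamma> t)))
           (at t within {0..}) \<and>
        lam t $ 6 = 0 \<and>
        (lam t $ 3)\<^sup>2 + (lam t $ 4)\<^sup>2 + (lam t $ 5)\<^sup>2 = 1 \<and>
        ((\<lambda>\<tau>. lam \<tau> $ 1) has_real_derivative - (lam t $ 3 * lam t $ 5)) (at t within {0..}) \<and>
        ((\<lambda>\<tau>. lam \<tau> $ 2) has_real_derivative lam t $ 3 * lam t $ 4) (at t within {0..}) \<and>
        ((\<lambda>\<tau>. lam \<tau> $ 3) has_real_derivative lam t $ 1 * lam t $ 5 - lam t $ 2 * lam t $ 4)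
           (at t within {0..}) \<and>
        ((\<lambda>\<tau>. lam \<tau> $ 4) has_real_derivative lam t $ 3 * lam t $ 2) (at t within {0..}) \<and>
        ((\<lambda>\<tau>. lam \<tau> $ 5) has_real_derivative - (lam t $ 3 * lam t $ 1)) (at t within {0..}))"

definition mom1 :: "real^6 \<Rightarrow> real^2" where
  "mom1 p = vector [- p $ 1, - p $ 2]"

definition mom2 :: "real^6 \<Rightarrow> real^2" where
  "mom2 p = vector [p $ 5, - p $ 4]"

definition integral_W :: "real^6 \<Rightarrow> real" where
  "integral_W p = - p $ 1 * p $ 4 - p $ 2 * p $ 5"

definition integral_c :: "real^6 \<Rightarrow> real" where
  "integral_c p = sqrt ((p $ 1)\<^sup>2 + (p $ 2)\<^sup>2 + (p $ 3)\<^sup>2)"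

text \<open>Momentum components as functions of spatial arclength \<open>s\<close>, for initial momentum \<open>p\<close>.\<close>

definition lam4_arc :: "real^6 \<Rightarrow> real \<Rightarrow> real" where
  "lam4_arc p s = p $ 4 * cosh s + p $ 2 * sinh s"

definition lam5_arc :: "real^6 \<Rightarrow> real \<Rightarrow> real" where
  "lam5_arc p s = p $ 5 * cosh s - p $ 1 * sinh s"

definition lam3_arc :: "real^6 \<Rightarrow> real \<Rightarrow> real" where
  "lam3_arc p s = sqrt (1 - (lam4_arc p s)\<^sup>2 - (lam5_arc p s)\<^sup>2)"

definition is_min_of :: "real \<Rightarrow> real set \<Rightarrow> bool" where
  "is_min_of m S \<longleftrightarrow> m \<in> S \<and> (\<forall>x\<in>S. m \<le> x)"

definition spatial_projection :: "(real \<Rightarrow> se3) \<Rightarrow> real \<Rightarrow> real^3" where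
  "spatial_projection \<gamma> t = fst (\<gamma> t)"

definition spatial_arclength :: "(real \<Rightarrow> se3) \<Rightarrow> real \<Rightarrow> real" where
  "spatial_arclength \<gamma> t =
     integral {0..t} (\<lambda>\<tau>. norm (vector_derivative (spatial_projection \<gamma>) (at \<tau> within {0..})))"

text \<open>Cusps of the spatial projection in terms of the control \<open>u\<close> in front of \<open>A3\<close>. A geodesic with
  end time \<open>T\<close> has a cusp iff there is a cusp time \<open>t < T\<close>.\<close>

definition cusp_time :: "(real \<Rightarrow> real) \<Rightarrow> real \<Rightarrow> bool" where
  "cusp_time u t \<longleftrightarrow> 0 < t \<and> u t = 0 \<and> deriv u t \<noteq> 0"

end

theory Submission
  imports Defs
begin

text \<open>
  Let \<open>\<sigma>\<close> be the primitive of \<open>\<lambda>\<^sub>3\<close> with \<open>\<sigma>(0) = 0\<close>. The momentum equations become linear in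
  \<open>\<sigma>\<close>, so \<open>\<lambda>\<^sub>3\<^sup>2\<close> is a function of \<open>\<sigma>\<close> and, up to the factor \<open>-4 X\<close>, a quadratic polynomial in
  \<open>X = exp (2\<sigma>)\<close> with leading coefficient \<open>a\<^sup>2\<close>; if \<open>a \<noteq> 0\<close>, its larger root is
  \<open>exp (2 s\<^sub>m\<^sub>a\<^sub>x)\<close>. Moreover
  \<open>\<lambda>\<^sub>3'' = -\<lambda>\<^sub>3 (\<lambda>\<^sub>1\<^sup>2 + \<lambda>\<^sub>2\<^sup>2 + \<lambda>\<^sub>4\<^sup>2 + \<lambda>\<^sub>5\<^sup>2)\<close>, so \<open>\<lambda>\<^sub>3\<close> is concave while it is nonnegative.
  Hence its first positive zero is transversal; and if there were none, \<open>\<lambda>\<^sub>3\<close> would be nondecreasing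
  and \<open>\<sigma>\<close> unbounded, contradicting the bound by \<open>s\<^sub>m\<^sub>a\<^sub>x\<close>. If \<open>a = 0\<close>, then
  \<open>\<lambda>\<^sub>3' = 1 - \<lambda>\<^sub>3\<^sup>2 \<ge> 0\<close> and \<open>\<lambda>\<^sub>3\<close> never returns to zero.
\<close>

section \<open>Larger root of a quadratic, and monotonicity from derivatives within a set\<close>

lemma quadratic_larger_root:
  fixes A B C D R :: real and q :: "real \<Rightarrow> real"
  assumes q: "\<And>X. q X = A * X\<^sup>2 - 2 * C * X + B" and R: "R = (C + 2 * sqrt D) / A"
    and A: "A > 0" and disc: "C\<^sup>2 - A * B = 4 * D"
    and q1: "q 1 \<le> 0" and slope: "q 1 = 0 \<longrightarrow> A < C"
  shows "R > 1" "q R = 0" "q X \<le> 0 \<Longrightarrow> X \<le> R" "X > 1 \<Longrightarrow> q X = 0 \<Longrightarrow> X = R"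
proof -
  \<comment> \<open>Completing the square: \<open>q X \<le> 0\<close> confines \<open>A * X\<close>
    to the interval of radius \<open>2 * sqrt D\<close> about \<open>C\<close>, whose right end is
    \<open>A * R\<close>.\<close>
  have square: "A * q X = (A * X - C)\<^sup>2 - 4 * D" for X
    using disc by (simp add: q power2_eq_square algebra_simps)
  have le: "(A * X - C)\<^sup>2 \<le> 4 * D" if "q X \<le> 0" for X
    using square[of X] mult_nonneg_nonpos[of A "q X"] that A by simp
  have D: "D \<ge> 0"
    using le[OF q1] zero_le_power2[of "A * 1 - C"] by linarith
  define r where "r = sqrt D"
  have r: "r \<ge> 0" "D = r\<^sup>2" using D by (simp_all add: r_def)
  have abs_le: "\<bar>A * X - C\<bar> \<le> 2 * r" if "q X \<le> 0" for X
    using le[OF that] r abs_le_square_iff[of "A * X - C" "2 * r"]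
    by (simp add: power_mult_distrib)
  have AR: "A * R = C + 2 * r" using A by (simp add: R r_def)
  show upper: "X \<le> R" if "q X \<le> 0" for X
  proof -
    have "A * X \<le> A * R" using abs_le[OF that] AR by linarith
    then show ?thesis using A by simp
  qed
  have "A * q R = 0" using square[of R] AR r by (simp add: power_mult_distrib)
  then show root: "q R = 0" using A by simp
  \<comment> \<open>If 1 is itself a root, \<open>A < C\<close> says that \<open>q\<close> has
    negative slope there, so 1 is the smaller root.\<close>
  have "R \<noteq> 1"
  proof
    assume "R = 1"
    then have "A < C" using root slope by simp
    moreover have "A = C + 2 * r" using AR \<open>R = 1\<close> by simp
    ultimately show False using r by linarith
  qed
  then show "R > 1" using upper[OF q1] by simp
  show "X = R" if "X > 1" "q X = 0"
  proof -
    have "(A * X - C)\<^sup>2 = (2 * r)\<^sup>2" using square[of X] that r by (simp add: power_mult_distrib)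
    then have "A * X - C = 2 * r \<or> A * X - C = - (2 * r)" by (simp only: power2_eq_iff)
    moreover have "A * X > A * 1" using A that by simp
    ultimately have "A * X = A * R" using abs_le[OF q1] AR by auto
    then show ?thesis using A by simp
  qed
qed

text \<open>Adapts the usual criterion to derivatives within \<open>{0..}\<close>, which are
  one-sided at 0. The sign of \<open>f'\<close> is required only in the open interval, so
  \<open>a\<close> and \<open>b\<close> may be zeros or the starting time.\<close>

lemma DERIV_within_nonpos_imp_le:
  fixes f :: "real \<Rightarrow> real"
  assumes "a \<le> b" "{a..b} \<subseteq> S"
    and "\<And>x. a \<le> x \<Longrightarrow> x \<le> b \<Longrightarrow> (f has_real_derivative f' x) (at x within S)"
    and "\<And>x. a < x \<Longrightarrow> x < b \<Longrightarrow> f' x \<le> 0"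
  shows "f b \<le> f a"
proof (rule DERIV_nonpos_imp_decreasing_open[OF assms(1)])
  have D: "(f has_real_derivative f' x) (at x within {a..b})" if "a \<le> x" "x \<le> b" for x
    using has_field_derivative_subset[OF assms(3)[OF that] assms(2)] .
  then show "continuous_on {a..b} f"
    by (intro DERIV_continuous_on[of _ _ f']) simp
  show "\<exists>y. DERIV f x :> y \<and> y \<le> 0" if "a < x" "x < b" for x
    using D[of x] assms(4)[OF that] that by (auto simp: at_within_Icc_at)
qed

section \<open>The momentum equations and their solution in signed arclength\<close>

locale momentum_flow =
  fixes l1 l2 l3 l4 l5 :: "real \<Rightarrow> real"
  assumes d1: "t \<ge> 0 \<Longrightarrow> (l1 has_real_derivative - (l3 t * l5 t)) (at t within {0..})"
    and d2: "t \<ge> 0 \<Longrightarrow> (l2 has_real_derivative l3 t * l4 t) (at t within {0..})"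
    and d3: "t \<ge> 0 \<Longrightarrow> (l3 has_real_derivative l1 t * l5 t - l2 t * l4 t) (at t within {0..})"
    and d4: "t \<ge> 0 \<Longrightarrow> (l4 has_real_derivative l3 t * l2 t) (at t within {0..})"
    and d5: "t \<ge> 0 \<Longrightarrow> (l5 has_real_derivative - (l3 t * l1 t)) (at t within {0..})"
    and energy: "t \<ge> 0 \<Longrightarrow> (l3 t)\<^sup>2 + (l4 t)\<^sup>2 + (l5 t)\<^sup>2 = 1"
    and l3_starts_pos: "\<forall>\<^sub>F t in at_right 0. l3 t > 0"
begin

abbreviation l3' :: "real \<Rightarrow> real" where
  "l3' t \<equiv> l1 t * l5 t - l2 t * l4 t"

lemma l3_continuous: "continuous_on {0..} l3"
  by (rule DERIV_continuous_on[of _ _ l3']) (simp add: d3)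

lemma l3_deriv:
  assumes "t > 0"
  shows "deriv l3 t = l3' t"
proof -
  have "at t within {0..} = at t"
    using assms by (intro at_within_interior) simp
  then show ?thesis using d3[of t] assms by (simp add: DERIV_imp_deriv)
qed

text \<open>The integrand keeps its sign: this is spatial arclength only as long as
  \<open>l3\<close> is nonnegative, but it linearizes the momentum equations for all times.\<close>

definition sigma :: "real \<Rightarrow> real" where
  "sigma t = integral {0..t} l3"

lemma sigma_0: "sigma 0 = 0"
  by (simp add: sigma_def)

lemma sigma_deriv:
  assumes "t \<ge> 0"
  shows "(sigma has_real_derivative l3 t) (at t within {0..})"
proof -
  \<comment> \<open>The right end \<open>t + 1\<close> leaves room beyond \<open>t\<close>, so that
    derivatives within \<open>{0..t + 1}\<close> and within \<open>{0..}\<close> agree at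
    \<open>t\<close>.\<close>
  have "continuous_on {0..t + 1} l3"
    by (rule continuous_on_subset[OF l3_continuous]) auto
  then have "((\<lambda>u. integral {0..u} l3) has_real_derivative l3 t) (at t within {0..t + 1})"
    using assms by (intro integral_has_real_derivative) auto
  moreover have "at t within {0..t + 1} = at t within {0..}"
    by (rule at_within_nhd[of _ "{..<t + 1}"]) auto
  ultimately show ?thesis unfolding sigma_def by simp
qed

text \<open>The integrating factor \<open>exp (- (k * sigma t))\<close> turns \<open>y\<close> into
  a function with zero derivative.\<close>

lemma linear_in_sigma:
  fixes k :: real
  assumes y: "\<And>t. t \<ge> 0 \<Longrightarrow> (y has_real_derivative k * l3 t * y t) (at t within {0..})"
    and t: "t \<ge> 0"
  shows "y t = y 0 * exp (k * sigma t)"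
proof -
  have "\<exists>c. \<forall>t\<in>{0..}. y t * exp (- (k * sigma t)) = c"
  proof (rule has_field_derivative_zero_constant)
    fix t :: real
    assume "t \<in> {0..}"
    then show "((\<lambda>t. y t * exp (- (k * sigma t))) has_real_derivative 0) (at t within {0..})"
      by (auto intro!: derivative_eq_intros y sigma_deriv simp: algebra_simps)
  qed simp
  then have "y t * exp (- (k * sigma t)) = y 0 * exp (- (k * sigma 0))"
    using t by (metis atLeast_iff order_refl)
  then show ?thesis by (simp add: sigma_0 exp_minus field_simps)
qed

text \<open>These combinations diagonalize the linear system in \<open>sigma\<close>: the first two
  are the growing modes with eigenvalue 1, the last two the decaying modes with eigenvalue
  -1.\<close>

lemma momentum_exp:
  assumes "t \<ge> 0"
  shows "l4 t + l2 t = (l4 0 + l2 0) * exp (sigma t)"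
    and "l5 t - l1 t = (l5 0 - l1 0) * exp (sigma t)"
    and "l4 t - l2 t = (l4 0 - l2 0) * exp (- sigma t)"
    and "l5 t + l1 t = (l5 0 + l1 0) * exp (- sigma t)"
proof -
  have "l4 t + l2 t = (l4 0 + l2 0) * exp (1 * sigma t)"
    by (rule linear_in_sigma)
      (use assms in \<open>auto intro!: derivative_eq_intros d2 d4 simp: algebra_simps\<close>)
  then show "l4 t + l2 t = (l4 0 + l2 0) * exp (sigma t)" by simp
  have "l5 t - l1 t = (l5 0 - l1 0) * exp (1 * sigma t)"
    by (rule linear_in_sigma)
      (use assms in \<open>auto intro!: derivative_eq_intros d1 d5 simp: algebra_simps\<close>)
  then show "l5 t - l1 t = (l5 0 - l1 0) * exp (sigma t)" by simp
  have "l4 t - l2 t = (l4 0 - l2 0) * exp (- 1 * sigma t)"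
    by (rule linear_in_sigma)
      (use assms in \<open>auto intro!: derivative_eq_intros d2 d4 simp: algebra_simps\<close>)
  then show "l4 t - l2 t = (l4 0 - l2 0) * exp (- sigma t)" by simp
  have "l5 t + l1 t = (l5 0 + l1 0) * exp (- 1 * sigma t)"
    by (rule linear_in_sigma)
      (use assms in \<open>auto intro!: derivative_eq_intros d1 d5 simp: algebra_simps\<close>)
  then show "l5 t + l1 t = (l5 0 + l1 0) * exp (- sigma t)" by simp
qed

section \<open>Concavity and monotonicity of \<open>l3\<close>\<close>

lemma l3'_decreasing:
  assumes "0 \<le> u" "u \<le> v" and nonneg: "\<And>t. u < t \<Longrightarrow> t < v \<Longrightarrow> l3 t \<ge> 0"
  shows "l3' v \<le> l3' u"
proof (rule DERIV_within_nonpos_imp_le[where S = "{0..}" and f = l3' and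
      f' = "\<lambda>t. - (l3 t * ((l1 t)\<^sup>2 + (l2 t)\<^sup>2 + (l4 t)\<^sup>2 + (l5 t)\<^sup>2))"])
  fix t assume "u \<le> t" "t \<le> v"
  then have "t \<ge> 0" using assms by simp
  then show "(l3' has_real_derivative
      - (l3 t * ((l1 t)\<^sup>2 + (l2 t)\<^sup>2 + (l4 t)\<^sup>2 + (l5 t)\<^sup>2))) (at t within {0..})"
    by (auto intro!: derivative_eq_intros d1 d2 d4 d5 simp: algebra_simps power2_eq_square)
next
  fix t assume "u < t" "t < v"
  then show "- (l3 t * ((l1 t)\<^sup>2 + (l2 t)\<^sup>2 + (l4 t)\<^sup>2 + (l5 t)\<^sup>2)) \<le> 0"
    using nonneg by simp
qed (use assms in auto)

lemma l3_antimono: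
  assumes "0 \<le> u" "u \<le> v" "\<And>t. u < t \<Longrightarrow> t < v \<Longrightarrow> l3' t \<le> 0"
  shows "l3 v \<le> l3 u"
  by (rule DERIV_within_nonpos_imp_le[where S = "{0..}" and f' = l3']) (use assms d3 in auto)

lemma l3_mono:
  assumes "0 \<le> u" "u \<le> v" "\<And>t. u < t \<Longrightarrow> t < v \<Longrightarrow> l3' t \<ge> 0"
  shows "l3 u \<le> l3 v"
proof -
  have "- l3 v \<le> - l3 u"
    by (rule DERIV_within_nonpos_imp_le[where S = "{0..}" and f = "\<lambda>t. - l3 t" and
          f' = "\<lambda>t. - l3' t"])
      (use assms in \<open>auto intro!: derivative_eq_intros d3\<close>)
  then show ?thesis by simp
qed

lemma obtain_l3_pos:
  obtains e where "e > 0" "\<And>t. 0 < t \<Longrightarrow> t \<le> e \<Longrightarrow> l3 t > 0"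
proof -
  obtain b where "b > 0" "\<forall>t>0. t < b \<longrightarrow> l3 t > 0"
    using l3_starts_pos by (auto simp: eventually_at_right_field)
  then show ?thesis using that[of "b / 2"] by auto
qed

text \<open>By concavity a nonpositive slope at 0 would persist while \<open>l3\<close> is positive,
  so \<open>l3\<close> could not rise above its initial value 0.\<close>

lemma l3'_0_pos:
  assumes "l3 0 = 0"
  shows "l3' 0 > 0"
proof (rule ccontr)
  assume neg: "\<not> l3' 0 > 0"
  obtain e where e: "e > 0" "\<And>t. 0 < t \<Longrightarrow> t \<le> e \<Longrightarrow> l3 t > 0" by (rule obtain_l3_pos) blast
  have "l3' t \<le> 0" if "0 < t" "t < e" for t
    using l3'_decreasing[of 0 t] e(2) neg that by force
  then have "l3 e \<le> l3 0" using e by (intro l3_antimono) auto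
  then show False using e(2)[of e] e(1) assms by simp
qed

section \<open>The quadratic behind the cusp formula, and the case of vanishing growing
  modes\<close>

definition a2 :: real where
  "a2 = (l5 0 - l1 0)\<^sup>2 + (l4 0 + l2 0)\<^sup>2"

definition c2 :: real where
  "c2 = (l1 0)\<^sup>2 + (l2 0)\<^sup>2 + (l3 0)\<^sup>2"

definition W0 :: real where
  "W0 = - l1 0 * l4 0 - l2 0 * l5 0"

text \<open>The outer coefficients are the squared norms of the initial growing and decaying modes;
  \<open>X\<close> stands for \<open>exp (2 * s)\<close>.\<close>

definition q :: "real \<Rightarrow> real" where
  "q X = a2 * X\<^sup>2 - 2 * (1 + c2) * X + ((l4 0 - l2 0)\<^sup>2 + (l5 0 + l1 0)\<^sup>2)"

text \<open>An identity in every real \<open>s\<close>, so it serves both the explicit arclength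
  formula and the flow at \<open>s = sigma t\<close>. In \<open>E = exp s\<close> it is rational,
  and the energy at time 0 eliminates \<open>l3 0\<close>.\<close>

lemma q_exp:
  "1 - (l4 0 * cosh s + l2 0 * sinh s)\<^sup>2 - (l5 0 * cosh s - l1 0 * sinh s)\<^sup>2
     = - q (exp (2 * s)) / (4 * exp (2 * s))"
proof -
  define E where "E = exp s"
  have E: "E > 0" "exp (2 * s) = E\<^sup>2" "exp (- s) = 1 / E"
    using exp_double[of s] by (simp_all add: E_def exp_minus inverse_eq_divide)
  have l3: "(l3 0)\<^sup>2 = 1 - (l4 0)\<^sup>2 - (l5 0)\<^sup>2" using energy[of 0] by simp
  have ch: "cosh s = (E + 1 / E) / 2" and sh: "sinh s = (E - 1 / E) / 2"
    by (simp_all add: cosh_def sinh_def E(3) flip: E_def)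
  show ?thesis
    unfolding q_def a2_def c2_def l3 E(2) ch sh using E(1)
    by (simp add: divide_simps) (simp add: eval_nat_numeral algebra_simps)
qed

lemma l3_sq_sigma:
  assumes "t \<ge> 0"
  shows "(l3 t)\<^sup>2 = - q (exp (2 * sigma t)) / (4 * exp (2 * sigma t))"
proof -
  have "l4 t = l4 0 * cosh (sigma t) + l2 0 * sinh (sigma t)"
    "l5 t = l5 0 * cosh (sigma t) - l1 0 * sinh (sigma t)"
    using momentum_exp[OF assms] by (simp_all add: cosh_def sinh_def field_simps)
  then show ?thesis using energy[OF assms] q_exp[of "sigma t"] by simp
qed

definition smax :: real where
  "smax = 1 / 2 * ln ((1 + c2 + 2 * sqrt (c2 - W0\<^sup>2)) / a2)"

text \<open>With the growing modes zero for all times, \<open>l3'\<close> is a sum of squares, and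
  \<open>l3\<close> cannot drop below the positive value it has at some small time
  \<open>e\<close>.\<close>

lemma l3_pos_if_a2_zero:
  assumes "a2 = 0" "t > 0"
  shows "l3 t > 0"
proof -
  have a: "l5 0 - l1 0 = 0" "l4 0 + l2 0 = 0"
    using assms(1) by (simp_all add: a2_def)
  have l3': "l3' u \<ge> 0" if "u \<ge> 0" for u
  proof -
    have "l1 u = l5 u" "l2 u = - l4 u" using momentum_exp(1,2)[OF that] a by simp_all
    then show ?thesis by simp
  qed
  obtain e where e: "e > 0" "\<And>t. 0 < t \<Longrightarrow> t \<le> e \<Longrightarrow> l3 t > 0" by (rule obtain_l3_pos) blast
  show ?thesis
  proof (cases "t \<le> e")
    case False
    then have "l3 e \<le> l3 t" using e l3' by (intro l3_mono) auto
    then show ?thesis using e(1) e(2)[of e] by simp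
  qed (use e assms in auto)
qed

section \<open>Existence, transversality and arclength of the first cusp when \<open>a2\<close> is
  nonzero\<close>

context
  assumes a2: "a2 \<noteq> 0"
begin

lemma smax_root:
  shows "smax > 0" "q (exp (2 * smax)) = 0"
    and "q (exp (2 * s)) \<le> 0 \<Longrightarrow> s \<le> smax"
    and "s > 0 \<Longrightarrow> q (exp (2 * s)) = 0 \<Longrightarrow> s = smax"
proof -
  define B where "B = (l4 0 - l2 0)\<^sup>2 + (l5 0 + l1 0)\<^sup>2"
  define R where "R = (1 + c2 + 2 * sqrt (c2 - W0\<^sup>2)) / a2"
  have l3: "(l3 0)\<^sup>2 = 1 - (l4 0)\<^sup>2 - (l5 0)\<^sup>2" using energy[of 0] by simp
  have pos: "a2 > 0" using a2 unfolding a2_def by (simp add: sum_power2_gt_zero_iff)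
  have q1: "q 1 = - 4 * (l3 0)\<^sup>2"
    using l3_sq_sigma[of 0] by (simp add: sigma_0)
  \<comment> \<open>A quarter of the discriminant of \<open>q\<close>; this is where the first
    integral \<open>W0\<close> enters.\<close>
  have disc: "(1 + c2)\<^sup>2 - a2 * B = 4 * (c2 - W0\<^sup>2)"
    unfolding a2_def B_def c2_def W0_def l3
    by (simp add: power2_eq_square algebra_simps)
  \<comment> \<open>For \<open>l3 0 = 0\<close> the slope of \<open>q\<close> at 1 is
    \<open>-4 * l3' 0\<close>, which is negative because \<open>l3\<close> leaves 0 upwards.\<close>
  have slope: "q 1 = 0 \<longrightarrow> a2 < 1 + c2"
  proof
    assume "q 1 = 0"
    then have z: "l3 0 = 0" using q1 by simp
    then have "1 + c2 - a2 = 2 * l3' 0" using l3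
      unfolding a2_def c2_def by (simp add: power2_eq_square algebra_simps)
    then show "a2 < 1 + c2" using l3'_0_pos[OF z] by simp
  qed
  have q: "q X = a2 * X\<^sup>2 - 2 * (1 + c2) * X + B" for X by (simp add: q_def B_def)
  have "q 1 \<le> 0" using q1 by simp
  note R = quadratic_larger_root[OF q R_def pos disc this slope]
  have "2 * smax = ln R" by (simp add: smax_def R_def)
  then have exp: "exp (2 * smax) = R" using R(1) by simp
  show "q (exp (2 * smax)) = 0" using R(2) exp by simp
  show "smax > 0" using R(1) exp one_less_exp_iff[of "2 * smax"] by simp
  show "s \<le> smax" if "q (exp (2 * s)) \<le> 0"
    using R(3)[OF that] unfolding exp[symmetric] by simp
  show "s = smax" if "s > 0" "q (exp (2 * s)) = 0"
    using R(4)[OF _ that(2)] that(1) unfolding exp[symmetric] by simp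
qed

lemma sigma_le_smax:
  assumes "t \<ge> 0"
  shows "sigma t \<le> smax"
proof -
  have "q (exp (2 * sigma t)) = - 4 * exp (2 * sigma t) * (l3 t)\<^sup>2"
    using l3_sq_sigma[OF assms] by simp
  then have "q (exp (2 * sigma t)) \<le> 0" by simp
  then show ?thesis by (rule smax_root)
qed

lemma ex_nonpos: "\<exists>t>0. l3 t \<le> 0"
proof (rule ccontr)
  assume "\<not> ?thesis"
  then have pos: "l3 t > 0" if "t > 0" for t using that by force
  have l3': "l3' u \<ge> 0" if "u > 0" for u
  proof (rule ccontr)
    assume neg: "\<not> l3' u \<ge> 0"
    \<comment> \<open>The tangent to \<open>l3\<close> at \<open>u\<close> meets zero at
      \<open>v\<close>, and the concave graph lies below it.\<close>
    define v where "v = u - l3 u / l3' u"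
    have v: "v > u" using neg pos[OF that] by (simp add: v_def divide_pos_neg)
    have "l3 v - l3' u * (v - u) \<le> l3 u - l3' u * (u - u)"
    proof (rule DERIV_within_nonpos_imp_le[where S = "{0..}" and
          f = "\<lambda>t. l3 t - l3' u * (t - u)" and f' = "\<lambda>t. l3' t - l3' u"])
      show "l3' t - l3' u \<le> 0" if "u < t" "t < v" for t
        using l3'_decreasing[of u t] less_imp_le[OF pos] \<open>u > 0\<close> that by simp
    qed (use v that in \<open>auto intro!: derivative_eq_intros d3\<close>)
    then have "l3 v \<le> 0" using neg by (simp add: v_def)
    then show False using pos[of v] v that by simp
  qed
  \<comment> \<open>Chosen so that \<open>sigma 1 + l3 1 * (v - 1) = smax + 1\<close>; the left side
    bounds \<open>sigma v\<close> from below since \<open>l3\<close> does not decrease.\<close>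
  define v where "v = 1 + (1 + smax - sigma 1) / l3 1"
  have v: "v > 1" using sigma_le_smax[of 1] pos[of 1] by (simp add: v_def)
  have "l3 1 * (v - 1) - sigma v \<le> l3 1 * (1 - 1) - sigma 1"
  proof (rule DERIV_within_nonpos_imp_le[where S = "{0..}" and
        f = "\<lambda>t. l3 1 * (t - 1) - sigma t" and f' = "\<lambda>t. l3 1 - l3 t"])
    show "l3 1 - l3 t \<le> 0" if "1 < t" "t < v" for t
      using l3_mono[of 1 t] l3' that by simp
  qed (use v in \<open>auto intro!: derivative_eq_intros sigma_deriv\<close>)
  then have "sigma v > smax" using pos[of 1] by (simp add: v_def)
  then show False using sigma_le_smax[of v] v by simp
qed

lemma ex_first_zero:
  obtains t where "t > 0" "l3 t = 0" "\<And>u. 0 < u \<Longrightarrow> u < t \<Longrightarrow> l3 u > 0"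
proof -
  obtain e where e: "e > 0" "\<And>t. 0 < t \<Longrightarrow> t \<le> e \<Longrightarrow> l3 t > 0" by (rule obtain_l3_pos) blast
  obtain T where T: "T > 0" "l3 T \<le> 0" using ex_nonpos by blast
  have eT: "e < T" using e(2)[of T] T by force
  \<comment> \<open>Zeros are collected from \<open>e\<close> on, since \<open>l3 0\<close> may
    vanish and must not count as the first zero.\<close>
  define Z where "Z = {t \<in> {e..T}. l3 t = 0}"
  have cont: "continuous_on {u..v} l3" if "u \<ge> 0" for u v
    by (rule continuous_on_subset[OF l3_continuous]) (use that in auto)
  have ivt: "\<exists>x. e \<le> x \<and> x \<le> v \<and> l3 x = 0" if "e \<le> v" "l3 v \<le> 0" for v
    using IVT2'[of l3 v 0 e] e(1) e(2)[of e] that cont[of e v] by force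
  have "closed Z" unfolding Z_def
    by (intro continuous_closed_preimage_constant cont) (use e in auto)
  moreover have "bounded Z" by (rule bounded_subset[of "{e..T}"]) (auto simp: Z_def)
  ultimately have "compact Z" by (simp add: compact_eq_bounded_closed)
  moreover have "Z \<noteq> {}" using ivt[of T] eT T by (auto simp: Z_def)
  ultimately obtain t where t: "t \<in> Z" "\<And>u. u \<in> Z \<Longrightarrow> t \<le> u"
    using compact_attains_inf by metis
  have "l3 u > 0" if u: "0 < u" "u < t" for u
  proof (rule ccontr)
    assume neg: "\<not> l3 u > 0"
    then have "e \<le> u" using e(2)[of u] u by force
    then obtain x where "e \<le> x" "x \<le> u" "l3 x = 0" using ivt[of u] neg by auto
    then have "x \<in> Z" using u t(1) by (auto simp: Z_def)
    then show False using t(2)[of x] \<open>x \<le> u\<close> u by simp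
  qed
  then show ?thesis using that[of t] t(1) e(1) by (auto simp: Z_def)
qed

lemma first_cusp:
  obtains t1 where "is_min_of t1 {t. cusp_time l3 t}"
    "\<And>t. t \<ge> 0 \<Longrightarrow> integral {0..t} (\<lambda>\<tau>. \<bar>l3 \<tau>\<bar>) = smax \<longleftrightarrow> t = t1"
proof -
  obtain t1 where t1: "t1 > 0" "l3 t1 = 0" and pos: "\<And>u. 0 < u \<Longrightarrow> u < t1 \<Longrightarrow> l3 u > 0"
    by (rule ex_first_zero) blast
  have d: "l3' t1 \<noteq> 0"
  \<comment> \<open>Were the slope zero at \<open>t1\<close>, concavity would make it nonnegative
    before, so \<open>l3\<close> could not fall from \<open>l3 (t1 / 2) > 0\<close> to 0.\<close>
  proof
    assume z: "l3' t1 = 0"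
    have "l3' u \<ge> 0" if "t1 / 2 < u" "u < t1" for u
      using l3'_decreasing[of u t1] less_imp_le[OF pos] z that t1 by simp
    then have "l3 (t1 / 2) \<le> l3 t1" using t1 by (intro l3_mono) auto
    then show False using pos[of "t1 / 2"] t1 by simp
  qed
  define L where "L = (\<lambda>t. integral {0..t} (\<lambda>\<tau>. \<bar>l3 \<tau>\<bar>))"
  have cont: "continuous_on {u..v} (\<lambda>\<tau>. \<bar>l3 \<tau>\<bar>)" if "u \<ge> 0" for u v
    by (intro continuous_on_rabs continuous_on_subset[OF l3_continuous]) (use that in auto)
  have nonneg: "l3 u \<ge> 0" if "0 \<le> u" "u \<le> t1" for u
  proof (cases "u = 0")
    case True
    have "(l3 \<longlongrightarrow> l3 0) (at_right 0)"
      using l3_continuous by (auto simp: continuous_on_def intro: tendsto_within_subset)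
    moreover have "\<forall>\<^sub>F t in at_right 0. l3 t \<ge> 0"
      using l3_starts_pos by eventually_elim simp
    ultimately show ?thesis using True by (auto intro: tendsto_lowerbound)
  next
    case False
    then show ?thesis using pos[of u] t1 that by (cases "u = t1") auto
  qed
  \<comment> \<open>Two equal values of \<open>L\<close> leave zero integral for the continuous
    nonnegative integrand in between, so it vanishes there.\<close>
  have zero: "l3 x = 0" if L: "L u = L v" and "0 \<le> u" "u < v" "u \<le> x" "x \<le> v" for u v x
  proof -
    have "L u + integral {u..v} (\<lambda>\<tau>. \<bar>l3 \<tau>\<bar>) = L v" unfolding L_def
      by (rule Henstock_Kurzweil_Integration.integral_combine)
        (use that in \<open>auto intro: integrable_continuous_real cont\<close>)
    then have "integral {u..v} (\<lambda>\<tau>. \<bar>l3 \<tau>\<bar>) = 0" using L by simp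
    then have "\<forall>x\<in>{u..v}. \<bar>l3 x\<bar> = 0"
      using integral_eq_0_iff[of u v "\<lambda>\<tau>. \<bar>l3 \<tau>\<bar>"] cont[of u v] that by simp
    then show ?thesis using that by simp
  qed
  have L1: "L t1 = sigma t1"
    unfolding L_def sigma_def by (rule integral_cong) (use nonneg in auto)
  have "L 0 = 0" by (simp add: L_def)
  then have "L t1 \<noteq> 0" using zero[of 0 t1 "t1 / 2"] pos[of "t1 / 2"] t1 by auto
  moreover have "L t1 \<ge> 0" unfolding L_def
    by (intro integral_nonneg integrable_continuous_real cont) auto
  moreover have "q (exp (2 * sigma t1)) = 0" using l3_sq_sigma[of t1] t1 by simp
  ultimately have s1: "L t1 = smax" using smax_root(4)[of "sigma t1"] L1 by simp
  have uniq: "t = t1" if "t \<ge> 0" "L t = smax" for t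
  proof (rule ccontr)
    assume "t \<noteq> t1"
    then consider "t < t1" | "t1 < t" by linarith
    then show False
    proof cases
      case 1
      then show False
        using zero[of t t1 "(t + t1) / 2"] pos[of "(t + t1) / 2"] that s1 by simp
    next
      case 2
      \<comment> \<open>If \<open>L\<close> stayed at \<open>smax\<close> up to \<open>t\<close>,
        then \<open>l3\<close> would vanish on \<open>{t1..t}\<close> and have right derivative 0 at
        \<open>t1\<close>, against \<open>d\<close>.\<close>
      have "at t1 within {0..} = at t1"
        using t1 by (intro at_within_interior) simp
      then have "(l3 has_real_derivative l3' t1) (at t1 within {t1..t})"
        using d3[of t1] t1 by (auto intro: has_field_derivative_at_within)
      moreover have "(l3 has_real_derivative 0) (at t1 within {t1..t})"
        by (rule has_field_derivative_transform_within[of "\<lambda>_. 0" _ _ _ 1])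
          (use zero[of t1 t] 2 t1 that s1 in auto)
      moreover have "at t1 within {t1..t} \<noteq> bot"
        using 2 by (simp add: at_within_Icc_at_right)
      ultimately show False using d vector_derivative_unique_within
        unfolding has_real_derivative_iff_has_vector_derivative by blast
    qed
  qed
  show ?thesis
  proof
    show "is_min_of t1 {t. cusp_time l3 t}"
      unfolding is_min_of_def cusp_time_def
    proof (intro conjI ballI CollectI)
      show "t1 \<le> t" if "t \<in> {t. 0 < t \<and> l3 t = 0 \<and> deriv l3 t \<noteq> 0}" for t
        using that pos[of t] by force
    qed (use t1 d in \<open>simp_all add: l3_deriv\<close>)
    show "integral {0..t} (\<lambda>\<tau>. \<bar>l3 \<tau>\<bar>) = smax \<longleftrightarrow> t = t1" if "t \<ge> 0" for t
      using uniq[OF that] s1 unfolding L_def by blast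
  qed
qed

end

end

section \<open>From geodesics in SE(3) to the momentum flow and the cusp criterion\<close>

lemma mec_geodesic_momentum_flow:
  assumes geo: "mec_geodesic \<gamma> lam"
    and boundary: "norm (mom2 (lam 0)) = 1 \<Longrightarrow> \<forall>\<^sub>F t in at_right 0. lam t $ 3 > 0"
  shows "momentum_flow (\<lambda>t. lam t $ 1) (\<lambda>t. lam t $ 2) (\<lambda>t. lam t $ 3) (\<lambda>t. lam t $ 4)
           (\<lambda>t. lam t $ 5)"
proof
  note g = geo[unfolded mec_geodesic_def]
  show "\<forall>\<^sub>F t in at_right 0. lam t $ 3 > 0"
  \<comment> \<open>A zero initial value means \<open>mom2\<close> has norm 1, so
    \<open>boundary\<close> applies; otherwise the square root is positive and continuity
    suffices.\<close>
  proof (cases "lam 0 $ 3 = 0")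
    case True
    then have "(lam 0 $ 5)\<^sup>2 + (lam 0 $ 4)\<^sup>2 = 1" using g by force
    then show ?thesis by (intro boundary) (simp add: mom2_def norm_vec_def L2_set_def sum_2)
  next
    case False
    have "(lam 0 $ 3)\<^sup>2 + (lam 0 $ 4)\<^sup>2 + (lam 0 $ 5)\<^sup>2 = 1" using g by blast
    then have "1 - (lam 0 $ 4)\<^sup>2 - (lam 0 $ 5)\<^sup>2 \<ge> 0"
      using zero_le_power2[of "lam 0 $ 3"] by linarith
    then have "lam 0 $ 3 > 0" using g False by (metis order_le_less real_sqrt_ge_zero)
    moreover have "((\<lambda>t. lam t $ 3) has_real_derivative
        lam 0 $ 1 * lam 0 $ 5 - lam 0 $ 2 * lam 0 $ 4) (at 0 within {0..})"
      using g by blast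
    then have "((\<lambda>t. lam t $ 3) \<longlongrightarrow> lam 0 $ 3) (at 0 within {0..})"
      using DERIV_continuous continuous_within by blast
    then have "((\<lambda>t. lam t $ 3) \<longlongrightarrow> lam 0 $ 3) (at_right 0)"
      by (rule tendsto_within_subset) auto
    ultimately show ?thesis by (rule order_tendstoD(1)[rotated])
  qed
qed (use geo in \<open>simp_all add: mec_geodesic_def\<close>)

text \<open>Only \<open>A3\<close> moves the spatial part, and the rotation keeps its direction a
  unit vector. The absolute value accounts for motion in reverse after a cusp.\<close>

lemma spatial_arclength_mec_geodesic:
  assumes geo: "mec_geodesic \<gamma> lam"
  shows "spatial_arclength \<gamma> t = integral {0..t} (\<lambda>\<tau>. \<bar>lam \<tau> $ 3\<bar>)"
  unfolding spatial_arclength_def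
proof (rule integral_cong)
  fix \<tau> assume "\<tau> \<in> {0..t}"
  then have \<tau>: "\<tau> \<ge> 0" by simp
  have "at_right \<tau> \<le> at \<tau> within {0..}" using \<tau> by (intro at_le) auto
  then have nontriv: "at \<tau> within {0..} \<noteq> bot"
    by (metis bot_unique trivial_limit_at_right_real)
  have g: "\<gamma> \<tau> \<in> SE3" "(\<gamma> has_vector_derivative
      (lam \<tau> $ 3 *\<^sub>R A3 (\<gamma> \<tau>) + lam \<tau> $ 4 *\<^sub>R A4 (\<gamma> \<tau>) + lam \<tau> $ 5 *\<^sub>R A5 (\<gamma> \<tau>)))
      (at \<tau> within {0..})"
    using geo \<tau> by (simp_all add: mec_geodesic_def)
  have "(spatial_projection \<gamma> has_vector_derivative
      lam \<tau> $ 3 *\<^sub>R (snd (\<gamma> \<tau>) *v axis 3 1)) (at \<tau> within {0..})"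
    using bounded_linear.has_vector_derivative[OF bounded_linear_fst g(2)]
    by (simp add: A3_def A4_def A5_def left_inv_field_def spatial_projection_def[abs_def])
  then have "vector_derivative (spatial_projection \<gamma>) (at \<tau> within {0..})
      = lam \<tau> $ 3 *\<^sub>R (snd (\<gamma> \<tau>) *v axis 3 1)"
    using nontriv by (intro vector_derivative_within)
  moreover have "norm (snd (\<gamma> \<tau>) *v axis 3 1) = 1"
  proof -
    have "orthogonal_transformation ((*v) (snd (\<gamma> \<tau>)))"
      using g(1) by (simp add: SE3_def rotation_matrix_def orthogonal_transformation_matrix)
    then show ?thesis by (simp add: orthogonal_transformation_norm)
  qed
  ultimately show "norm (vector_derivative (spatial_projection \<gamma>) (at \<tau> within {0..}))
      = \<bar>lam \<tau> $ 3\<bar>" by simp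
qed

theorem theorem5:
  fixes \<gamma> :: "real \<Rightarrow> se3" and lam :: "real \<Rightarrow> real^6"
  assumes geo: "mec_geodesic \<gamma> lam"
    and le1: "norm (mom2 (lam 0)) \<le> 1"
    and boundary: "norm (mom2 (lam 0)) = 1 \<Longrightarrow> \<forall>\<^sub>F t in at_right 0. lam t $ 3 > 0"
  defines "u3 \<equiv> (\<lambda>t. lam t $ 3)"
    and "c \<equiv> integral_c (lam 0)"
    and "W \<equiv> integral_W (lam 0)"
    and "a \<equiv> norm (mom2 (lam 0) + mom1 (lam 0))"
  defines "s_max \<equiv> 1 / 2 * ln ((1 + c\<^sup>2 + 2 * sqrt (c\<^sup>2 - W\<^sup>2)) / a\<^sup>2)"
  shows "(a \<noteq> 0 \<longrightarrow>
            is_min_of s_max {s. s > 0 \<and> lam3_arc (lam 0) s = 0} \<and>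
            (\<exists>t1. is_min_of t1 {t. cusp_time u3 t} \<and>
                  (\<forall>t\<ge>0. spatial_arclength \<gamma> t = s_max \<longleftrightarrow> t = t1))) \<and>
         ((\<forall>T>0. \<not> (\<exists>t<T. cusp_time u3 t)) \<longleftrightarrow> a = 0)"
proof -
  interpret momentum_flow "\<lambda>t. lam t $ 1" "\<lambda>t. lam t $ 2" "\<lambda>t. lam t $ 3" "\<lambda>t. lam t $ 4"
    "\<lambda>t. lam t $ 5"
    using geo boundary by (rule mec_geodesic_momentum_flow)
  have a2: "a2 = a\<^sup>2"
    by (simp add: a2_def a_def mom1_def mom2_def norm_vec_def L2_set_def sum_2 power2_commute
        algebra_simps)
  have c2: "c2 = c\<^sup>2" by (simp add: c2_def c_def integral_c_def)
  have W0: "W0 = W" by (simp add: W0_def W_def integral_W_def)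
  have smax: "smax = s_max" by (simp add: smax_def s_max_def a2 c2 W0)
  \<comment> \<open>The real \<open>sqrt\<close> vanishes only at 0, also for negative arguments, so
    no bound on \<open>s\<close> is required.\<close>
  have arc: "lam3_arc (lam 0) s = 0 \<longleftrightarrow> q (exp (2 * s)) = 0" for s
    using q_exp[of s] by (simp add: lam3_arc_def lam4_arc_def lam5_arc_def)
  have no_cusp: "\<not> cusp_time u3 t" if "a = 0" for t
    using l3_pos_if_a2_zero[of t] that by (auto simp: cusp_time_def u3_def a2)
  have min: "is_min_of s_max {s. s > 0 \<and> lam3_arc (lam 0) s = 0}" if "a \<noteq> 0"
  proof -
    have "a2 \<noteq> 0" using that a2 by simp
    note root = smax_root[OF this]
    have "s_max \<le> s" if "s > 0" "lam3_arc (lam 0) s = 0" for s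
      using root(4)[of s] that unfolding arc smax by simp
    then show ?thesis using root(1,2) unfolding is_min_of_def smax by (simp add: arc)
  qed
  have ex: "\<exists>t1. is_min_of t1 {t. cusp_time u3 t} \<and>
      (\<forall>t\<ge>0. spatial_arclength \<gamma> t = s_max \<longleftrightarrow> t = t1)" if "a \<noteq> 0"
  proof -
    have "a2 \<noteq> 0" using that a2 by simp
    from first_cusp[OF this] obtain t1 where "is_min_of t1 {t. cusp_time u3 t}"
      "\<And>t. t \<ge> 0 \<Longrightarrow> spatial_arclength \<gamma> t = s_max \<longleftrightarrow> t = t1"
      unfolding spatial_arclength_mec_geodesic[OF geo] smax u3_def by blast
    then show ?thesis by blast
  qed
  have "\<exists>T>0. \<exists>t<T. cusp_time u3 t" if "a \<noteq> 0"
  proof -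
    obtain t1 where t1: "cusp_time u3 t1"
      using ex \<open>a \<noteq> 0\<close> by (auto simp: is_min_of_def)
    \<comment> \<open>A cusp time has to lie strictly before the end time, hence
      \<open>t1 + 1\<close>.\<close>
    then have "t1 + 1 > 0" by (simp add: cusp_time_def)
    then show ?thesis using t1 less_add_one[of t1] by blast
  qed
  then show ?thesis using no_cusp min ex by blast
qed

end
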